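(* Let $R$ be a QNA with Goodearl–Yakimov elements $y_1,\ldots,y_N$. For all subsets $I,J\subseteq[1,N]$, we have, inside the skew-field of fractions of $R$, $$RE_I^{-1}\cap RE_J^{-1}=RE_{I\cap J}^{-1}.$$
   Context: ${\mathbb K}$ is a field of characteristic $0$. A quantum nilpotent algebra (QNA) is an iterated Ore extension $R={\mathbb K}[x_1][x_2;\sigma_2,\delta_2]\cdots[x_N;\sigma_N,\delta_N]$, where $R_k={\mathbb K}[x_1][x_2;\sigma_2,\delta_2]\cdots[x_k;\sigma_k,\delta_k]$ ($R_0={\mathbb K}$), $\sigma_k$ is a ${\mathbb K}$-automorphism and $\delta_k$ a $\sigma_k$-derivation of $R_{k-1}$, together with a torus $\mathcal H$ acting rationally by ${\mathbb K}$-automorphisms on $R$ with each $x_i$ an $\mathcal H$-eigenvector, such that: (i) $\sigma_k(x_j)=\lambda_{kj}x_j$ for $j<k$, with $\lambda_{kj}\in{\mathbb K}^*$; (ii) $\delta_k$ is locally nilpotent on $R_{k-1}$; (iii) for each $k$ there exist $h_k\in\mathcal H$ and $q_k\in{\mathbb K}^*$ not a root of unity such that $h_k$ acts on $R_{k-1}$ as $\sigma_k$ and $h_k\cdot x_k=q_kx_k$. The rank is $n=|\{k:\delta_k=0\}|$ and $\mathcal H=({\mathbb K}^* )^n$ is taken maximal. Homogeneous elements are the $\mathcal H$-eigenvectors. An element $u$ is normal if $uR=Ru$; a prime element is a nonzero normal $p$ with $pR$ a completely prime ideal. Goodearl–Yakimov elements: there is a surjective map $\mu:[1,N]\to[1,n]$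 with predecessor $p(k)=\max\{j<k:\mu(j)=\mu(k)\}$ (or $-\infty$ if none) and successor $s(k)=\min\{j>k:\mu(j)=\mu(k)\}$ (or $+\infty$ if none), and homogeneous elements $y_1,\ldots,y_N\in R$, uniquely determined, with $y_k=x_k$ if $p(k)=-\infty$ and $y_k=y_{p(k)}x_k-c_k$ for some $c_k\in R_{k-1}$ otherwise, such that for every $k$ the set $\{y_j: j\le k,\ s(j)>k\}$ is, up to nonzero scalars, the set of homogeneous prime elements of $R_k$. The $y_i$ pairwise quasi-commute. For $I\subseteq[1,N]$, $E_I$ denotes the multiplicative subset of $R$ generated by $\{y_k:k\in I\}$ (together with $1$); it is an Ore set, and $RE_I^{-1}$ denotes the corresponding localization, viewed inside the skew-field of fractions of $R$. *)

theory Defs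
  imports Main
begin

text \<open>Throughout, the ambient type 'a (a division ring) plays the role of the skew-field of
fractions of R; the base field K, the algebra R and all subalgebras R_k are subsets of it.\<close>

definition is_subfield :: "'a::division_ring set \<Rightarrow> bool" where
  "is_subfield K \<longleftrightarrow> 0 \<in> K \<and> 1 \<in> K \<and>
     (\<forall>a\<in>K. \<forall>b\<in>K. a + b \<in> K \<and> a * b \<in> K \<and> - a \<in> K) \<and>
     (\<forall>a\<in>K. a \<noteq> 0 \<longrightarrow> inverse a \<in> K)"

inductive_set gen_ring :: "'a::ring_1 set \<Rightarrow> 'a set" for S where
  base: "a \<in> S \<Longrightarrow> a \<in> gen_ring S"
| zero: "0 \<in> gen_ring S"
| one: "1 \<in> gen_ring S"
| neg: "a \<in> gen_ring S \<Longrightarrow> - a \<in> gen_ring S"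
| add: "a \<in> gen_ring S \<Longrightarrow> b \<in> gen_ring S \<Longrightarrow> a + b \<in> gen_ring S"
| mult: "a \<in> gen_ring S \<Longrightarrow> b \<in> gen_ring S \<Longrightarrow> a * b \<in> gen_ring S"

text \<open>R_k = K[x_1][x_2;..]...[x_k;..], the K-subalgebra generated by x_1,...,x_k; R_0 = K.\<close>
definition Rk :: "'a::division_ring set \<Rightarrow> (nat \<Rightarrow> 'a) \<Rightarrow> nat \<Rightarrow> 'a set" where
  "Rk K x k = gen_ring (K \<union> x ` {1..k})"

definition ore_ext :: "'a::division_ring set \<Rightarrow> 'a set \<Rightarrow> 'a \<Rightarrow> ('a \<Rightarrow> 'a) \<Rightarrow> ('a \<Rightarrow> 'a) \<Rightarrow> bool" where
  "ore_ext K A t \<sigma> \<delta> \<longleftrightarrow>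
     bij_betw \<sigma> A A \<and>
     (\<forall>a\<in>A. \<forall>b\<in>A. \<sigma> (a + b) = \<sigma> a + \<sigma> b \<and> \<sigma> (a * b) = \<sigma> a * \<sigma> b) \<and>
     (\<forall>c\<in>K. \<sigma> c = c) \<and>
     \<delta> ` A \<subseteq> A \<and>
     (\<forall>a\<in>A. \<forall>b\<in>A. \<delta> (a + b) = \<delta> a + \<delta> b \<and> \<delta> (a * b) = \<sigma> a * \<delta> b + \<delta> a * b) \<and>
     (\<forall>c\<in>K. \<forall>a\<in>A. \<delta> (c * a) = c * \<delta> a) \<and>
     (\<forall>a\<in>A. t * a = \<sigma> a * t + \<delta> a) \<and>
     (\<forall>(c::nat \<Rightarrow> 'a) m. (\<forall>i\<le>m. c i \<in> A) \<longrightarrow> (\<Sum>i\<le>m. c i * t ^ i) = 0 \<longrightarrow> (\<forall>i\<le>m. c i = 0))"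

definition torus :: "'a::division_ring set \<Rightarrow> nat \<Rightarrow> (nat \<Rightarrow> 'a) set" where
  "torus K n = {h. (\<forall>i<n. h i \<in> K \<and> h i \<noteq> 0) \<and> (\<forall>i\<ge>n. h i = 1)}"

definition homogeneous :: "'a::division_ring set \<Rightarrow> nat \<Rightarrow> ((nat \<Rightarrow> 'a) \<Rightarrow> 'a \<Rightarrow> 'a) \<Rightarrow> 'a \<Rightarrow> bool" where
  "homogeneous K n act u \<longleftrightarrow> u \<noteq> 0 \<and> (\<forall>h\<in>torus K n. \<exists>c\<in>K. act h u = c * u)"

definition normal_elt :: "'a::ring_1 set \<Rightarrow> 'a \<Rightarrow> bool" where
  "normal_elt A u \<longleftrightarrow> u \<in> A \<and> {u * r |r. r \<in> A} = {r * u |r. r \<in> A}"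

definition completely_prime :: "'a::ring_1 set \<Rightarrow> 'a set \<Rightarrow> bool" where
  "completely_prime A P \<longleftrightarrow> P \<subseteq> A \<and> P \<noteq> A \<and>
     (\<forall>a\<in>A. \<forall>b\<in>A. a * b \<in> P \<longrightarrow> a \<in> P \<or> b \<in> P)"

definition prime_elt :: "'a::ring_1 set \<Rightarrow> 'a \<Rightarrow> bool" where
  "prime_elt A u \<longleftrightarrow> u \<noteq> 0 \<and> normal_elt A u \<and> completely_prime A {u * r |r. r \<in> A}"

definition QNA ::
  "'a::division_ring set \<Rightarrow> nat \<Rightarrow> (nat \<Rightarrow> 'a) \<Rightarrow> (nat \<Rightarrow> 'a \<Rightarrow> 'a) \<Rightarrow> (nat \<Rightarrow> 'a \<Rightarrow> 'a)
    \<Rightarrow> (nat \<Rightarrow> nat \<Rightarrow> 'a) \<Rightarrow> nat \<Rightarrow> ((nat \<Rightarrow> 'a) \<Rightarrow> 'a \<Rightarrow> 'a) \<Rightarrow> bool" where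
  "QNA K N x \<sigma> \<delta> lam n act \<longleftrightarrow>
     is_subfield K \<and> (\<forall>m::nat. m > 0 \<longrightarrow> (of_nat m :: 'a) \<noteq> 0) \<and>
     (\<forall>c\<in>K. \<forall>r\<in>Rk K x N. c * r = r * c) \<and>
     (\<forall>k\<in>{1..N}. ore_ext K (Rk K x (k - 1)) (x k) (\<sigma> k) (\<delta> k)) \<and>
     \<comment> \<open>(i)\<close>
     (\<forall>k\<in>{1..N}. \<forall>j\<in>{1..<k}. lam k j \<in> K \<and> lam k j \<noteq> 0 \<and> \<sigma> k (x j) = lam k j * x j) \<and>
     \<comment> \<open>(ii)\<close>
     (\<forall>k\<in>{1..N}. \<forall>a\<in>Rk K x (k - 1). \<exists>m. (\<delta> k ^^ m) a = 0) \<and>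
     \<comment> \<open>rank\<close>
     n = card {k\<in>{1..N}. \<forall>a\<in>Rk K x (k - 1). \<delta> k a = 0} \<and>
     \<comment> \<open>action of H = (K^*)^n on R by K-algebra automorphisms\<close>
     (\<forall>h\<in>torus K n. bij_betw (act h) (Rk K x N) (Rk K x N) \<and>
        (\<forall>a\<in>Rk K x N. \<forall>b\<in>Rk K x N. act h (a + b) = act h a + act h b \<and> act h (a * b) = act h a * act h b) \<and>
        (\<forall>c\<in>K. act h c = c)) \<and>
     (\<forall>a\<in>Rk K x N. act (\<lambda>i. 1) a = a) \<and>
     (\<forall>h\<in>torus K n. \<forall>h'\<in>torus K n. \<forall>a\<in>Rk K x N. act (\<lambda>i. h i * h' i) a = act h (act h' a)) \<and>
     \<comment> \<open>rationality: each x_i is an eigenvector with a rational character\<close>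
     (\<exists>e::nat \<Rightarrow> nat \<Rightarrow> int. \<forall>i\<in>{1..N}. \<forall>h\<in>torus K n.
         act h (x i) = prod_list (map (\<lambda>j. h j powi e i j) [0..<n]) * x i) \<and>
     \<comment> \<open>(iii)\<close>
     (\<forall>k\<in>{1..N}. \<exists>h\<in>torus K n. (\<forall>a\<in>Rk K x (k - 1). act h a = \<sigma> k a) \<and>
         (\<exists>q\<in>K. q \<noteq> 0 \<and> (\<forall>m::nat. m > 0 \<longrightarrow> q ^ m \<noteq> 1) \<and> act h (x k) = q * x k))"

text \<open>Predecessor set {j < k : mu j = mu k}; p(k) is its maximum when nonempty.\<close>
definition pred_set :: "(nat \<Rightarrow> nat) \<Rightarrow> nat \<Rightarrow> nat set" where
  "pred_set \<mu> k = {j\<in>{1..<k}. \<mu> j = \<mu> k}"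

text \<open>Goodearl--Yakimov elements y_1..y_N with respect to mu.  The condition s(j) > k
  means no j' with j < j' \<le> k has mu j' = mu j.\<close>
definition GY_elements ::
  "'a::division_ring set \<Rightarrow> nat \<Rightarrow> (nat \<Rightarrow> 'a) \<Rightarrow> nat \<Rightarrow> ((nat \<Rightarrow> 'a) \<Rightarrow> 'a \<Rightarrow> 'a)
     \<Rightarrow> (nat \<Rightarrow> nat) \<Rightarrow> (nat \<Rightarrow> 'a) \<Rightarrow> bool" where
  "GY_elements K N x n act \<mu> y \<longleftrightarrow>
     \<mu> ` {1..N} = {1..n} \<and>
     (\<forall>k\<in>{1..N}. y k \<in> Rk K x N \<and> homogeneous K n act (y k)) \<and>
     (\<forall>k\<in>{1..N}. if pred_set \<mu> k = {} then y k = x k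
                  else (\<exists>c\<in>Rk K x (k - 1). y k = y (Max (pred_set \<mu> k)) * x k - c)) \<and>
     (\<forall>k\<in>{1..N}. \<forall>u.
        (u \<in> Rk K x k \<and> homogeneous K n act u \<and> prime_elt (Rk K x k) u) \<longleftrightarrow>
        (\<exists>j\<in>{1..k}. (\<forall>j'\<in>{j<..k}. \<mu> j' \<noteq> \<mu> j) \<and> (\<exists>c\<in>K. c \<noteq> 0 \<and> u = c * y j)))"

inductive_set mult_set :: "(nat \<Rightarrow> 'a::ring_1) \<Rightarrow> nat set \<Rightarrow> 'a set" for y I where
  one: "1 \<in> mult_set y I"
| step: "e \<in> mult_set y I \<Longrightarrow> k \<in> I \<Longrightarrow> e * y k \<in> mult_set y I"

text \<open>The localization R E^{-1} viewed inside the division ring (E is an Ore set).\<close>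
definition localization :: "'a::division_ring set \<Rightarrow> 'a set \<Rightarrow> 'a set" where
  "localization R E = {r * inverse e |r e. r \<in> R \<and> e \<in> E}"

end

theory Submission
  imports Defs
begin

text \<open>
  Two facts about the \<open>y\<^sub>k\<close> suffice: they quasi-commute, and for \<open>k \<noteq> l\<close> an element \<open>r\<close> of \<open>R\<close>
  with \<open>r y\<^sub>k \<in> R y\<^sub>l\<close> already lies in \<open>R y\<^sub>l\<close>. Indeed a denominator in \<open>E\<^sub>I\<close> then factors, up to a
  scalar, as \<open>g h\<close> with \<open>g \<in> E\<^bsub>I \<inter> J\<^esub>\<close> and \<open>h \<in> E\<^bsub>I - J\<^esub>\<close>, and the letters of \<open>h\<close> cancel one by one
  against a denominator in \<open>E\<^sub>J\<close>.

  Both facts come from leading coefficients in \<open>x\<^sub>k\<close> over \<open>R\<^bsub>k-1\<^esub>\<close>, where \<open>y\<^sub>k\<close> has degree one and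
  leading coefficient \<open>1\<close> or \<open>y\<^bsub>p(k)\<^esub>\<close>. Comparing them in \<open>y\<^sub>k y\<^sub>i = b y\<^sub>k\<close>, which normality of \<open>y\<^sub>k\<close>
  provides, gives quasi-commutation by induction on \<open>k\<close>. For \<open>k < l\<close> the second fact holds in \<open>R\<^sub>l\<close>
  because \<open>y\<^sub>l\<close> is prime there. It passes from \<open>R\<^sub>m\<close> to \<open>R\<^bsub>m+1\<^esub>\<close> because \<open>y\<^sub>k\<close> and \<open>y\<^sub>l\<close> are
  eigenvectors of \<open>\<sigma>\<^bsub>m+1\<^esub>\<close>, so that the leading coefficients of given degree of the elements of
  \<open>R\<^bsub>m+1\<^esub> y\<^sub>l\<close> form \<open>R\<^sub>m y\<^sub>l\<close>. It is symmetric in \<open>k\<close> and \<open>l\<close> because \<open>y\<^sub>k\<close> and \<open>y\<^sub>l\<close> quasi-commute.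
\<close>

section \<open>Subrings and regularity modulo a principal left ideal\<close>

locale subring =
  fixes A :: "'a::ring_1 set"
  assumes zero_closed [simp, intro]: "0 \<in> A"
    and one_closed [simp, intro]: "1 \<in> A"
    and add_closed [intro]: "a \<in> A \<Longrightarrow> b \<in> A \<Longrightarrow> a + b \<in> A"
    and mult_closed [intro]: "a \<in> A \<Longrightarrow> b \<in> A \<Longrightarrow> a * b \<in> A"
    and uminus_closed [intro]: "a \<in> A \<Longrightarrow> - a \<in> A"
begin

lemma diff_closed [intro]: "a \<in> A \<Longrightarrow> b \<in> A \<Longrightarrow> a - b \<in> A"
  using add_closed[of a "- b"] uminus_closed[of b] by simp

lemma power_closed [intro]: "a \<in> A \<Longrightarrow> a ^ m \<in> A"
  by (induction m) auto

end

lemma subring_gen_ring: "subring (gen_ring S)"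
  by unfold_locales (auto intro: gen_ring.intros)

lemma gen_ring_least:
  assumes "subring A" "S \<subseteq> A"
  shows "gen_ring S \<subseteq> A"
proof
  interpret subring A by fact
  fix a assume "a \<in> gen_ring S"
  then show "a \<in> A"
    by induction (use assms(2) in auto)
qed

lemma subset_gen_ring: "S \<subseteq> gen_ring S"
  by (auto intro: gen_ring.base)

lemma gen_ring_mono: "S \<subseteq> T \<Longrightarrow> gen_ring S \<subseteq> gen_ring T"
  using gen_ring_least[OF subring_gen_ring] subset_gen_ring by blast

definition left_multiples :: "'a::ring_1 set \<Rightarrow> 'a \<Rightarrow> 'a set" where
  "left_multiples A w = {a * w |a. a \<in> A}"

definition regular_modulo :: "'a::ring_1 set \<Rightarrow> 'a \<Rightarrow> 'a \<Rightarrow> bool" where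
  "regular_modulo A w u \<longleftrightarrow>
     (\<forall>r\<in>A. r * u \<in> left_multiples A w \<longrightarrow> r \<in> left_multiples A w)"

lemma left_multiplesI [intro]: "a \<in> A \<Longrightarrow> a * w \<in> left_multiples A w"
  by (auto simp: left_multiples_def)

lemma left_multiplesE [elim]:
  assumes "z \<in> left_multiples A w"
  obtains a where "a \<in> A" "z = a * w"
  using assms by (auto simp: left_multiples_def)

lemma regular_moduloI [intro]:
  "(\<And>r. r \<in> A \<Longrightarrow> r * u \<in> left_multiples A w \<Longrightarrow> r \<in> left_multiples A w)
    \<Longrightarrow> regular_modulo A w u"
  by (simp add: regular_modulo_def)

lemma regular_moduloD:
  "regular_modulo A w u \<Longrightarrow> r \<in> A \<Longrightarrow> r * u \<in> left_multiples A w \<Longrightarrow> r \<in> left_multiples A w"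
  by (simp add: regular_modulo_def)

lemma regular_modulo_one: "regular_modulo A w 1"
  by auto

lemma prime_elt_regular_modulo:
  assumes "prime_elt A w" "u \<in> A" "u \<notin> left_multiples A w"
  shows "regular_modulo A w u"
proof -
  have "{w * r |r. r \<in> A} = left_multiples A w"
    using assms(1) by (simp add: prime_elt_def normal_elt_def left_multiples_def)
  then have "completely_prime A (left_multiples A w)"
    using assms(1) by (simp add: prime_elt_def)
  then show ?thesis
    using assms(2,3) unfolding completely_prime_def by blast
qed

context subring
begin

lemma left_multiples_mult: "a \<in> A \<Longrightarrow> z \<in> left_multiples A w \<Longrightarrow> a * z \<in> left_multiples A w"
  by (force simp: left_multiples_def simp flip: mult.assoc)

lemma left_multiples_add:
  "z \<in> left_multiples A w \<Longrightarrow> z' \<in> left_multiples A w \<Longrightarrow> z + z' \<in> left_multiples A w"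
  by (force simp: left_multiples_def simp flip: distrib_right)

lemma left_multiples_diff:
  "z \<in> left_multiples A w \<Longrightarrow> z' \<in> left_multiples A w \<Longrightarrow> z - z' \<in> left_multiples A w"
  by (force simp: left_multiples_def simp flip: left_diff_distrib)

lemma regular_modulo_mult:
  assumes "u \<in> A" and regular: "regular_modulo A w u" "regular_modulo A w v"
  shows "regular_modulo A w (u * v)"
proof
  fix r assume "r \<in> A" "r * (u * v) \<in> left_multiples A w"
  then have "r * u \<in> left_multiples A w"
    using regular_moduloD[OF regular(2), of "r * u"] \<open>u \<in> A\<close> by (auto simp: mult.assoc)
  then show "r \<in> left_multiples A w"
    using regular_moduloD[OF regular(1)] \<open>r \<in> A\<close> by blast
qed

end

section \<open>Quasi-commutation over a central subfield\<close>

locale central_subfield =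
  fixes K :: "'a::division_ring set"
  assumes subfield: "is_subfield K"
    and central: "c \<in> K \<Longrightarrow> c * a = a * c"
begin

lemma K_zero: "0 \<in> K"
  and K_one: "1 \<in> K"
  and K_mult: "a \<in> K \<Longrightarrow> b \<in> K \<Longrightarrow> a * b \<in> K"
  and K_inverse: "a \<in> K \<Longrightarrow> inverse a \<in> K"
  using subfield by (auto simp: is_subfield_def)

lemma central_left_commute: "c \<in> K \<Longrightarrow> a * (c * b) = c * (a * b)"
  by (metis central mult.assoc)

definition eigenvector :: "('a \<Rightarrow> 'a) \<Rightarrow> 'a \<Rightarrow> bool" where
  "eigenvector f a \<longleftrightarrow> a \<noteq> 0 \<and> (\<exists>c\<in>K. f a = c * a)"

definition quasi_commute :: "'a \<Rightarrow> 'a \<Rightarrow> bool" where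
  "quasi_commute a b \<longleftrightarrow> (\<exists>c\<in>K. c \<noteq> 0 \<and> a * b = c * (b * a))"

lemma quasi_commuteI [intro]: "c \<in> K \<Longrightarrow> c \<noteq> 0 \<Longrightarrow> a * b = c * (b * a) \<Longrightarrow> quasi_commute a b"
  by (auto simp: quasi_commute_def)

lemma quasi_commuteE [elim]:
  assumes "quasi_commute a b"
  obtains c where "c \<in> K" "c \<noteq> 0" "a * b = c * (b * a)"
  using assms by (auto simp: quasi_commute_def)

lemma quasi_commute_refl: "quasi_commute a a"
  using K_one by (intro quasi_commuteI[of 1]) auto

lemma quasi_commute_one: "quasi_commute 1 a"
  using K_one by (intro quasi_commuteI[of 1]) auto

lemma quasi_commute_sym:
  assumes "quasi_commute a b"
  shows "quasi_commute b a"
proof -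
  obtain c where "c \<in> K" "c \<noteq> 0" and comm: "a * b = c * (b * a)"
    using assms ..
  then have "b * a = inverse c * (a * b)"
    by (simp flip: mult.assoc)
  then show ?thesis
    using \<open>c \<in> K\<close> \<open>c \<noteq> 0\<close> K_inverse by (intro quasi_commuteI[of "inverse c"]) auto
qed

lemma quasi_commute_mult:
  assumes "quasi_commute a b" "quasi_commute a' b"
  shows "quasi_commute (a * a') b"
proof -
  obtain c where c_in_K: "c \<in> K" and "c \<noteq> 0" and comm: "a * b = c * (b * a)"
    using assms(1) ..
  obtain c' where c'_in_K: "c' \<in> K" and "c' \<noteq> 0" and comm': "a' * b = c' * (b * a')"
    using assms(2) ..
  have "a * a' * b = c' * (a * b * a')"
    using comm' by (simp add: mult.assoc central_left_commute[OF c'_in_K])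
  also have "\<dots> = (c' * c) * (b * (a * a'))"
    using comm by (simp add: mult.assoc)
  finally show ?thesis
    using \<open>c \<noteq> 0\<close> \<open>c' \<noteq> 0\<close> K_mult[OF c'_in_K c_in_K] by (intro quasi_commuteI[of "c' * c"]) auto
qed

lemma quasi_commute_mult_set:
  assumes "e \<in> mult_set y I" "\<And>i. i \<in> I \<Longrightarrow> quasi_commute (y i) b"
  shows "quasi_commute e b"
  using assms(1) by induction (auto intro: quasi_commute_one quasi_commute_mult assms(2))

end

locale subalgebra = central_subfield K + subring A for K A :: "'a::division_ring set" +
  assumes K_subset: "K \<subseteq> A"
begin

lemma scale_closed_iff:
  assumes "c \<in> K" "c \<noteq> 0"
  shows "c * a \<in> A \<longleftrightarrow> a \<in> A"
proof
  assume "c * a \<in> A"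
  then have "inverse c * (c * a) \<in> A"
    using K_inverse[OF assms(1)] K_subset by blast
  then show "a \<in> A"
    using assms(2) by (simp flip: mult.assoc)
qed (use assms K_subset in blast)

lemma scale_mem_left_multiples_iff:
  assumes "c \<in> K" "c \<noteq> 0"
  shows "c * z \<in> left_multiples A w \<longleftrightarrow> z \<in> left_multiples A w"
proof
  assume "c * z \<in> left_multiples A w"
  then have "inverse c * (c * z) \<in> left_multiples A w"
    using K_inverse[OF assms(1)] K_subset left_multiples_mult by blast
  then show "z \<in> left_multiples A w"
    using assms(2) by (simp flip: mult.assoc)
qed (use assms K_subset left_multiples_mult in blast)

lemma quasi_commute_swap_closed:
  assumes "quasi_commute a b" "d * (b * a) \<in> A"
  shows "d * (a * b) \<in> A"
proof -
  obtain c where c_in_K: "c \<in> K" and comm: "a * b = c * (b * a)"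
    using assms(1) by blast
  have "d * (a * b) = c * (d * (b * a))"
    using comm by (simp add: central_left_commute[OF c_in_K])
  then show ?thesis
    using c_in_K K_subset assms(2) by auto
qed

lemma left_multiples_mult_quasi_commute:
  assumes "z \<in> left_multiples A w" "quasi_commute w u" "u \<in> A"
  shows "z * u \<in> left_multiples A w"
proof -
  obtain s where "s \<in> A" and z_eq: "z = s * w"
    using assms(1) ..
  obtain c where "c \<in> K" and comm: "w * u = c * (u * w)"
    using assms(2) by blast
  have "z * u = s * c * u * w"
    using z_eq comm by (simp add: mult.assoc)
  moreover have "s * c * u \<in> A"
    using \<open>s \<in> A\<close> \<open>c \<in> K\<close> \<open>u \<in> A\<close> K_subset by blast
  ultimately show ?thesis
    by auto
qed

lemma regular_modulo_sym:
  assumes "regular_modulo A u w" "quasi_commute u w" "u \<noteq> 0"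
  shows "regular_modulo A w u"
proof
  fix r assume "r \<in> A" "r * u \<in> left_multiples A w"
  then obtain s where "s \<in> A" and ru_eq: "r * u = s * w"
    by blast
  then have "s * w \<in> left_multiples A u"
    using \<open>r \<in> A\<close> by (metis left_multiplesI)
  then have "s \<in> left_multiples A u"
    by (rule regular_moduloD[OF assms(1) \<open>s \<in> A\<close>])
  then obtain g where "g \<in> A" and s_eq: "s = g * u"
    by blast
  obtain c where c_in_K: "c \<in> K" and comm: "u * w = c * (w * u)"
    using assms(2) by blast
  have "r * u = c * g * w * u"
    using ru_eq s_eq comm by (simp add: mult.assoc central_left_commute[OF c_in_K])
  then have "r = c * g * w"
    using \<open>u \<noteq> 0\<close> by simp
  then show "r \<in> left_multiples A w"
    using c_in_K \<open>g \<in> A\<close> K_subset by blast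
qed

end

section \<open>Leading coefficients in an Ore extension\<close>

locale ore_extension = subalgebra K A for K A :: "'a::division_ring set" +
  fixes t :: 'a and \<sigma> \<delta> :: "'a \<Rightarrow> 'a"
  assumes ore_ext: "ore_ext K A t \<sigma> \<delta>"
begin

lemma \<sigma>_closed: "a \<in> A \<Longrightarrow> \<sigma> a \<in> A"
  and \<sigma>_mult: "a \<in> A \<Longrightarrow> b \<in> A \<Longrightarrow> \<sigma> (a * b) = \<sigma> a * \<sigma> b"
  and \<sigma>_scalar: "c \<in> K \<Longrightarrow> \<sigma> c = c"
  and \<delta>_closed: "a \<in> A \<Longrightarrow> \<delta> a \<in> A"
  and t_mult: "a \<in> A \<Longrightarrow> t * a = \<sigma> a * t + \<delta> a"
  using ore_ext by (auto simp: ore_ext_def bij_betw_def)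

lemma powers_independent:
  assumes "\<And>i. i \<le> m \<Longrightarrow> c i \<in> A" "(\<Sum>i\<le>m. c i * t ^ i) = 0" "i \<le> m"
  shows "c i = 0"
proof -
  have "\<forall>c m. (\<forall>i\<le>m. c i \<in> A) \<longrightarrow> (\<Sum>i\<le>m. c i * t ^ i) = 0 \<longrightarrow> (\<forall>i\<le>m. c i = 0)"
    using ore_ext by (simp add: ore_ext_def)
  then show ?thesis
    using assms by blast
qed

lemma \<sigma>_nonzero:
  assumes "a \<in> A" "a \<noteq> 0"
  shows "\<sigma> a \<noteq> 0"
proof -
  have "inj_on \<sigma> A"
    using ore_ext by (simp add: ore_ext_def bij_betw_def)
  then show ?thesis
    using assms \<sigma>_scalar[OF K_zero] by (metis inj_onD zero_closed)
qed

lemma \<sigma>_pow_closed: "a \<in> A \<Longrightarrow> (\<sigma> ^^ m) a \<in> A"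
  by (induction m) (auto intro: \<sigma>_closed)

lemma \<sigma>_pow_nonzero: "a \<in> A \<Longrightarrow> a \<noteq> 0 \<Longrightarrow> (\<sigma> ^^ m) a \<noteq> 0"
  by (induction m) (simp_all add: \<sigma>_nonzero \<sigma>_pow_closed)

lemma eigenvector_\<sigma>_pow:
  assumes "a \<in> A" "eigenvector \<sigma> a"
  obtains c where "c \<in> K" "c \<noteq> 0" "(\<sigma> ^^ m) a = c * a"
proof -
  obtain b where "b \<in> K" and \<sigma>_a: "\<sigma> a = b * a"
    using assms(2) by (auto simp: eigenvector_def)
  have "\<exists>c\<in>K. (\<sigma> ^^ m) a = c * a"
  proof (induction m)
    case 0
    then show ?case using K_one by (auto intro!: bexI[of _ 1])
  next
    case (Suc m)
    then obtain c where "c \<in> K" "(\<sigma> ^^ m) a = c * a"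
      by blast
    then have "(\<sigma> ^^ Suc m) a = c * b * a"
      using \<sigma>_a assms(1) K_subset by (auto simp: \<sigma>_mult \<sigma>_scalar mult.assoc)
    then show ?case
      using K_mult[OF \<open>c \<in> K\<close> \<open>b \<in> K\<close>] by blast
  qed
  moreover have "(\<sigma> ^^ m) a \<noteq> 0"
    using assms \<sigma>_pow_nonzero by (simp add: eigenvector_def)
  ultimately show thesis
    using that by auto
qed

definition deg_lt :: "nat \<Rightarrow> 'a set" where
  "deg_lt m = {\<Sum>i<m. c i * t ^ i |c. \<forall>i. c i \<in> A}"

definition has_lead_coeff :: "'a \<Rightarrow> nat \<Rightarrow> 'a \<Rightarrow> bool" where
  "has_lead_coeff v m a \<longleftrightarrow> a \<in> A \<and> v - a * t ^ m \<in> deg_lt m"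

lemma deg_ltI: "(\<And>i. c i \<in> A) \<Longrightarrow> (\<Sum>i<m. c i * t ^ i) \<in> deg_lt m"
  by (auto simp: deg_lt_def)

lemma deg_ltE:
  assumes "v \<in> deg_lt m"
  obtains c where "\<forall>i. c i \<in> A" "v = (\<Sum>i<m. c i * t ^ i)"
  using assms by (auto simp: deg_lt_def)

lemma deg_lt_0: "deg_lt 0 = {0}"
  by (auto simp: deg_lt_def intro!: exI[of _ "\<lambda>_. 0"])

lemma deg_lt_Suc_iff: "v \<in> deg_lt (Suc m) \<longleftrightarrow> (\<exists>a. has_lead_coeff v m a)"
proof
  assume "v \<in> deg_lt (Suc m)"
  then obtain c where coeffs: "\<forall>i. c i \<in> A" and v_eq: "v = (\<Sum>i<Suc m. c i * t ^ i)"
    by (rule deg_ltE)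
  have "v - c m * t ^ m = (\<Sum>i<m. c i * t ^ i)"
    using v_eq by simp
  then have "has_lead_coeff v m (c m)"
    using coeffs by (auto simp: has_lead_coeff_def intro: deg_ltI)
  then show "\<exists>a. has_lead_coeff v m a" ..
next
  assume "\<exists>a. has_lead_coeff v m a"
  then obtain a where "a \<in> A" and lower: "v - a * t ^ m \<in> deg_lt m"
    by (auto simp: has_lead_coeff_def)
  obtain c where coeffs: "\<forall>i. c i \<in> A" and lower_eq: "v - a * t ^ m = (\<Sum>i<m. c i * t ^ i)"
    using lower by (rule deg_ltE)
  have "v = (\<Sum>i<Suc m. (c(m := a)) i * t ^ i)"
    using lower_eq by (simp add: algebra_simps)
  also have "\<dots> \<in> deg_lt (Suc m)"
    using \<open>a \<in> A\<close> coeffs by (intro deg_ltI) simp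
  finally show "v \<in> deg_lt (Suc m)" .
qed

lemma deg_lt_1: "deg_lt 1 = A"
  by (auto simp: deg_lt_Suc_iff has_lead_coeff_def deg_lt_0)

lemma deg_lt_zero: "0 \<in> deg_lt m"
  using deg_ltI[of "\<lambda>_. 0"] by auto

lemma deg_lt_add: "v \<in> deg_lt m \<Longrightarrow> w \<in> deg_lt m \<Longrightarrow> v + w \<in> deg_lt m"
proof (elim deg_ltE)
  fix c d assume "\<forall>i. c i \<in> A" "\<forall>i. d i \<in> A"
    and "v = (\<Sum>i<m. c i * t ^ i)" "w = (\<Sum>i<m. d i * t ^ i)"
  then show "v + w \<in> deg_lt m"
    using deg_ltI[of "\<lambda>i. c i + d i" m] by (auto simp: distrib_right sum.distrib)
qed

lemma deg_lt_lmult: "a \<in> A \<Longrightarrow> v \<in> deg_lt m \<Longrightarrow> a * v \<in> deg_lt m"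
proof (elim deg_ltE)
  fix c assume "a \<in> A" "\<forall>i. c i \<in> A" "v = (\<Sum>i<m. c i * t ^ i)"
  then show "a * v \<in> deg_lt m"
    using deg_ltI[of "\<lambda>i. a * c i" m] by (auto simp: sum_distrib_left mult.assoc)
qed

lemma deg_lt_uminus: "v \<in> deg_lt m \<Longrightarrow> - v \<in> deg_lt m"
  using deg_lt_lmult[of "- 1" v m] by auto

lemma deg_lt_diff: "v \<in> deg_lt m \<Longrightarrow> w \<in> deg_lt m \<Longrightarrow> v - w \<in> deg_lt m"
  using deg_lt_add[of v m "- w"] deg_lt_uminus[of w m] by simp

lemma deg_lt_sum: "(\<And>i. i \<in> S \<Longrightarrow> f i \<in> deg_lt m) \<Longrightarrow> sum f S \<in> deg_lt m"
  by (induction S rule: infinite_finite_induct) (auto intro: deg_lt_zero deg_lt_add)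

lemma has_lead_coeff_zero_iff: "has_lead_coeff v m 0 \<longleftrightarrow> v \<in> deg_lt m"
  by (simp add: has_lead_coeff_def)

lemma deg_lt_mono: "m \<le> n \<Longrightarrow> deg_lt m \<subseteq> deg_lt n"
  by (rule lift_Suc_mono_le[where f = deg_lt])
     (metis deg_lt_Suc_iff has_lead_coeff_zero_iff subsetI)

lemma has_lead_coeff_monom: "a \<in> A \<Longrightarrow> has_lead_coeff (a * t ^ m) m a"
  by (simp add: has_lead_coeff_def deg_lt_zero)

lemma monom_in_deg_lt: "a \<in> A \<Longrightarrow> i < m \<Longrightarrow> a * t ^ i \<in> deg_lt m"
  using has_lead_coeff_monom[of a i] deg_lt_Suc_iff deg_lt_mono[of "Suc i" m] by auto

lemma has_lead_coeff_scalar: "a \<in> A \<Longrightarrow> has_lead_coeff a 0 a"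
  using has_lead_coeff_monom[of a 0] by simp

lemma has_lead_coeff_linear: "p \<in> A \<Longrightarrow> c \<in> A \<Longrightarrow> has_lead_coeff (p * t - c) 1 p"
  using deg_lt_1 by (auto simp: has_lead_coeff_def)

lemma has_lead_coeff_diff:
  "has_lead_coeff v m a \<Longrightarrow> has_lead_coeff w m b \<Longrightarrow> has_lead_coeff (v - w) m (a - b)"
  using deg_lt_diff[of "v - a * t ^ m" m "w - b * t ^ m"]
  by (auto simp: has_lead_coeff_def algebra_simps)

lemma has_lead_coeff_of_zero:
  assumes "has_lead_coeff 0 m a"
  shows "a = 0"
proof -
  have "- (a * t ^ m) \<in> deg_lt m"
    using assms by (simp add: has_lead_coeff_def)
  then obtain c where coeffs: "\<forall>i. c i \<in> A" and expansion: "- (a * t ^ m) = (\<Sum>i<m. c i * t ^ i)"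
    by (rule deg_ltE)
  define d where "d = c(m := a)"
  have "(\<Sum>i\<le>m. d i * t ^ i) = (\<Sum>i<m. c i * t ^ i) + a * t ^ m"
    by (simp add: d_def lessThan_Suc_atMost[symmetric])
  also have "\<dots> = 0"
    by (simp flip: expansion)
  finally have "d m = 0"
    using assms coeffs by (intro powers_independent) (auto simp: d_def has_lead_coeff_def)
  then show ?thesis
    by (simp add: d_def)
qed

lemma has_lead_coeff_unique: "has_lead_coeff v m a \<Longrightarrow> has_lead_coeff v m b \<Longrightarrow> a = b"
  using has_lead_coeff_diff[of v m a v b] has_lead_coeff_of_zero by fastforce

lemma t_mult_deg_lt:
  assumes "v \<in> deg_lt m"
  shows "t * v \<in> deg_lt (Suc m)"
proof -
  obtain c where coeffs: "\<forall>i. c i \<in> A" and v_eq: "v = (\<Sum>i<m. c i * t ^ i)"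
    using assms by (rule deg_ltE)
  have "t * v = (\<Sum>i<m. \<sigma> (c i) * t ^ Suc i + \<delta> (c i) * t ^ i)"
    using coeffs v_eq by (simp add: sum_distrib_left t_mult distrib_right flip: mult.assoc)
  then show ?thesis
    using coeffs by (auto intro!: deg_lt_sum deg_lt_add monom_in_deg_lt \<sigma>_closed \<delta>_closed
        simp del: power_Suc)
qed

lemma power_mult_deg_lt: "v \<in> deg_lt m \<Longrightarrow> t ^ i * v \<in> deg_lt (i + m)"
  by (induction i) (auto simp: mult.assoc t_mult_deg_lt)

lemma deg_lt_mult:
  assumes "v \<in> deg_lt m" "w \<in> deg_lt (Suc n)"
  shows "v * w \<in> deg_lt (m + n)"
proof -
  obtain c where coeffs: "\<forall>i. c i \<in> A" and v_eq: "v = (\<Sum>i<m. c i * t ^ i)"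
    using assms(1) by (rule deg_ltE)
  have "t ^ i * w \<in> deg_lt (m + n)" if "i < m" for i
    using power_mult_deg_lt[OF assms(2)] deg_lt_mono[of "i + Suc n" "m + n"] that by auto
  then have "(\<Sum>i<m. c i * (t ^ i * w)) \<in> deg_lt (m + n)"
    by (intro deg_lt_sum deg_lt_lmult[OF coeffs[rule_format]]) simp
  then show ?thesis
    by (simp add: v_eq sum_distrib_right mult.assoc)
qed

lemma has_lead_coeff_power_mult:
  assumes "has_lead_coeff w n b"
  shows "has_lead_coeff (t ^ m * w) (m + n) ((\<sigma> ^^ m) b)"
proof (induction m)
  case 0
  then show ?case using assms by simp
next
  case (Suc m)
  define v a where "v = t ^ m * w" and "a = (\<sigma> ^^ m) b"
  have "a \<in> A" and lower: "v - a * t ^ (m + n) \<in> deg_lt (m + n)"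
    using Suc by (simp_all add: v_def a_def has_lead_coeff_def)
  have "t * v - \<sigma> a * t ^ Suc (m + n) = t * (v - a * t ^ (m + n)) + \<delta> a * t ^ (m + n)"
    using t_mult[OF \<open>a \<in> A\<close>] by (simp add: algebra_simps flip: mult.assoc)
  also have "\<dots> \<in> deg_lt (Suc (m + n))"
    using \<open>a \<in> A\<close> lower by (intro deg_lt_add t_mult_deg_lt monom_in_deg_lt \<delta>_closed) auto
  finally show ?case
    using \<open>a \<in> A\<close> by (simp add: has_lead_coeff_def v_def a_def \<sigma>_closed mult.assoc)
qed

lemma has_lead_coeff_mult:
  assumes "has_lead_coeff v m a" "has_lead_coeff w n b"
  shows "has_lead_coeff (v * w) (m + n) (a * (\<sigma> ^^ m) b)"
proof -
  have "(v - a * t ^ m) * w \<in> deg_lt (m + n)"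
    using assms by (intro deg_lt_mult) (auto simp: deg_lt_Suc_iff has_lead_coeff_def)
  moreover have "a * (t ^ m * w - (\<sigma> ^^ m) b * t ^ (m + n)) \<in> deg_lt (m + n)"
    using assms(1) has_lead_coeff_power_mult[OF assms(2)]
    by (intro deg_lt_lmult) (auto simp: has_lead_coeff_def)
  ultimately have "(v - a * t ^ m) * w + a * (t ^ m * w - (\<sigma> ^^ m) b * t ^ (m + n))
      \<in> deg_lt (m + n)"
    by (rule deg_lt_add)
  then have "v * w - a * (\<sigma> ^^ m) b * t ^ (m + n) \<in> deg_lt (m + n)"
    by (simp add: left_diff_distrib right_diff_distrib mult.assoc)
  then show ?thesis
    using assms \<sigma>_pow_closed by (auto simp: has_lead_coeff_def)
qed

abbreviation B :: "'a set" where
  "B \<equiv> gen_ring (A \<union> {t})"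

sublocale B: subalgebra K B
proof -
  interpret B: subring B by (rule subring_gen_ring)
  show "subalgebra K B"
    by unfold_locales (use K_subset subset_gen_ring in blast)
qed

lemma A_subset_B: "A \<subseteq> B" and t_in_B: "t \<in> B"
  using subset_gen_ring by blast+

lemma B_subset_deg_lt: "B \<subseteq> (\<Union>m. deg_lt m)"
proof (rule gen_ring_least)
  show "subring (\<Union>m. deg_lt m)"
  proof
    fix v w assume "v \<in> (\<Union>m. deg_lt m)" "w \<in> (\<Union>m. deg_lt m)"
    then obtain m n where v: "v \<in> deg_lt m" and w: "w \<in> deg_lt n"
      by blast
    show "v + w \<in> (\<Union>m. deg_lt m)"
      using v w deg_lt_mono[of m "m + n"] deg_lt_mono[of n "m + n"]
      by (intro UN_I[of "m + n"] deg_lt_add) auto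
    show "v * w \<in> (\<Union>m. deg_lt m)"
      using v w deg_lt_mono[of n "Suc n"] by (intro UN_I[of "m + n"] deg_lt_mult) auto
  qed (use deg_lt_1 deg_lt_uminus in blast)+
  show "A \<union> {t} \<subseteq> (\<Union>m. deg_lt m)"
    using deg_lt_1 monom_in_deg_lt[of 1 1 2] by force
qed

lemma nonzero_has_lead_coeff:
  assumes "r \<in> B" "r \<noteq> 0"
  obtains d a where "a \<noteq> 0" "has_lead_coeff r d a"
proof -
  have "\<exists>d a. a \<noteq> 0 \<and> has_lead_coeff r d a" if "r \<in> deg_lt m" for m
    using that
  proof (induction m)
    case 0
    then show ?case using assms(2) by (simp add: deg_lt_0)
  next
    case (Suc m)
    then show ?case using has_lead_coeff_zero_iff deg_lt_Suc_iff by metis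
  qed
  then show thesis
    using that B_subset_deg_lt assms(1) by blast
qed

lemma deg_lt_cancel_right:
  assumes "r \<in> B" and lead_q: "has_lead_coeff q e p" and "p \<noteq> 0"
    and rq_deg: "r * q \<in> deg_lt (d + e)"
  shows "r \<in> deg_lt d"
proof (cases "r = 0")
  case True
  then show ?thesis by (simp add: deg_lt_zero)
next
  case False
  then obtain k a where "a \<noteq> 0" and lead_r: "has_lead_coeff r k a"
    using \<open>r \<in> B\<close> nonzero_has_lead_coeff by blast
  have "k < d"
  proof (rule ccontr)
    assume "\<not> k < d"
    then have "has_lead_coeff (r * q) (k + e) 0"
      using rq_deg deg_lt_mono[of "d + e" "k + e"] by (auto simp: has_lead_coeff_zero_iff)
    then have "a * (\<sigma> ^^ k) p = 0"
      by (rule has_lead_coeff_unique[OF has_lead_coeff_mult[OF lead_r lead_q]])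
    then show False
      using \<open>a \<noteq> 0\<close> \<open>p \<noteq> 0\<close> lead_q \<sigma>_pow_nonzero by (auto simp: has_lead_coeff_def)
  qed
  then show ?thesis
    using lead_r deg_lt_Suc_iff deg_lt_mono[of "Suc k" d] by auto
qed

lemma not_left_multiple_of_higher_degree:
  assumes lead_q: "has_lead_coeff q e p" "p \<noteq> 0" and "e > 0" "w \<in> A" "w \<noteq> 0"
  shows "w \<notin> left_multiples B q"
proof
  assume "w \<in> left_multiples B q"
  then obtain b where "b \<in> B" and w_eq: "w = b * q" ..
  have "b * q \<in> deg_lt (0 + e)"
    using w_eq \<open>e > 0\<close> \<open>w \<in> A\<close> deg_lt_1 deg_lt_mono[of 1 e] by auto
  then have "b \<in> deg_lt 0"
    by (rule deg_lt_cancel_right[OF \<open>b \<in> B\<close> lead_q])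
  then show False
    using w_eq \<open>w \<noteq> 0\<close> by (simp add: deg_lt_0)
qed

lemma quasi_commute_from_lead_coeff:
  assumes lead_q: "has_lead_coeff q e p" and "p \<noteq> 0"
    and "w \<in> A" "eigenvector \<sigma> w"
    and "quasi_commute p w" and "q * w \<in> left_multiples B q"
  shows "quasi_commute q w"
proof -
  obtain b where "b \<in> B" and qw_eq: "q * w = b * q"
    using \<open>q * w \<in> left_multiples B q\<close> ..
  obtain s where s_in_K: "s \<in> K" and "s \<noteq> 0" and \<sigma>_w: "(\<sigma> ^^ e) w = s * w"
    using eigenvector_\<sigma>_pow[OF \<open>w \<in> A\<close> \<open>eigenvector \<sigma> w\<close>] .
  obtain c where c_in_K: "c \<in> K" and "c \<noteq> 0" and pw_eq: "p * w = c * (w * p)"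
    using \<open>quasi_commute p w\<close> ..
  have lead_qw: "has_lead_coeff (b * q) e (p * (\<sigma> ^^ e) w)"
    using has_lead_coeff_mult[OF lead_q has_lead_coeff_scalar[OF \<open>w \<in> A\<close>]] qw_eq by simp
  then have "b * q \<in> deg_lt (1 + e)"
    using deg_lt_Suc_iff by auto
  then have "b \<in> A"
    using deg_lt_cancel_right[OF \<open>b \<in> B\<close> lead_q \<open>p \<noteq> 0\<close>] deg_lt_1 by blast
  then have "has_lead_coeff (b * q) e (b * p)"
    using has_lead_coeff_mult[OF has_lead_coeff_scalar lead_q] by simp
  then have "b * p = p * (\<sigma> ^^ e) w"
    using lead_qw by (rule has_lead_coeff_unique)
  also have "\<dots> = s * c * w * p"
    using \<sigma>_w pw_eq by (simp add: central_left_commute[OF s_in_K] mult.assoc)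
  finally have "b = s * c * w"
    using \<open>p \<noteq> 0\<close> by simp
  then show ?thesis
    using qw_eq \<open>s \<noteq> 0\<close> \<open>c \<noteq> 0\<close> K_mult[OF s_in_K c_in_K]
    by (intro quasi_commuteI[of "s * c"]) (auto simp: mult.assoc)
qed

lemma lead_coeff_of_left_multiple:
  assumes "w \<in> A" "eigenvector \<sigma> w"
    and "z \<in> left_multiples B w" and lead_z: "has_lead_coeff z d a"
  shows "a \<in> left_multiples A w"
proof -
  obtain s where "s \<in> B" and z_eq: "z = s * w"
    using \<open>z \<in> left_multiples B w\<close> ..
  note lead_w = has_lead_coeff_scalar[OF \<open>w \<in> A\<close>]
  have "w \<noteq> 0"
    using \<open>eigenvector \<sigma> w\<close> by (simp add: eigenvector_def)
  have "s * w \<in> deg_lt (Suc d + 0)"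
    using lead_z z_eq deg_lt_Suc_iff by auto
  then have "s \<in> deg_lt (Suc d)"
    by (rule deg_lt_cancel_right[OF \<open>s \<in> B\<close> lead_w \<open>w \<noteq> 0\<close>])
  then obtain b where lead_s: "has_lead_coeff s d b"
    by (auto simp: deg_lt_Suc_iff)
  obtain c where "c \<in> K" and \<sigma>_w: "(\<sigma> ^^ d) w = c * w"
    using eigenvector_\<sigma>_pow[OF \<open>w \<in> A\<close> \<open>eigenvector \<sigma> w\<close>] by blast
  have "has_lead_coeff z d (b * (\<sigma> ^^ d) w)"
    using has_lead_coeff_mult[OF lead_s lead_w] z_eq by simp
  then have "a = b * c * w"
    using has_lead_coeff_unique[OF lead_z] \<sigma>_w by (simp add: mult.assoc)
  then show ?thesis
    using lead_s \<open>c \<in> K\<close> K_subset by (auto simp: has_lead_coeff_def)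
qed

lemma left_multiple_with_lead_coeff:
  assumes "w \<in> A" "eigenvector \<sigma> w" and "a \<in> left_multiples A w"
  obtains h where "h \<in> B" "has_lead_coeff (h * w) d a"
proof -
  obtain g where "g \<in> A" and a_eq: "a = g * w"
    using \<open>a \<in> left_multiples A w\<close> ..
  obtain c where c_in_K: "c \<in> K" and "c \<noteq> 0" and \<sigma>_w: "(\<sigma> ^^ d) w = c * w"
    using eigenvector_\<sigma>_pow[OF \<open>w \<in> A\<close> \<open>eigenvector \<sigma> w\<close>] .
  define b where "b = inverse c * g"
  have "b \<in> A"
    using \<open>g \<in> A\<close> K_inverse[OF c_in_K] K_subset by (auto simp: b_def)
  have "b * (\<sigma> ^^ d) w = inverse c * (c * (g * w))"
    by (simp add: b_def \<sigma>_w mult.assoc central_left_commute[OF c_in_K])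
  then have "b * (\<sigma> ^^ d) w = a"
    using \<open>c \<noteq> 0\<close> by (simp add: a_eq flip: mult.assoc)
  then have "has_lead_coeff (b * t ^ d * w) d a"
    using has_lead_coeff_mult[OF has_lead_coeff_monom has_lead_coeff_scalar, of b w d]
      \<open>b \<in> A\<close> \<open>w \<in> A\<close> by simp
  moreover have "b * t ^ d \<in> B"
    using \<open>b \<in> A\<close> A_subset_B t_in_B by blast
  ultimately show thesis
    using that by blast
qed

lemma lead_coeff_mem_left_multiples:
  assumes u: "u \<in> A" "eigenvector \<sigma> u" and w: "w \<in> A" "eigenvector \<sigma> w"
    and regular: "regular_modulo A w u"
    and ru: "r * u \<in> left_multiples B w" and lead_r: "has_lead_coeff r d a"
  shows "a \<in> left_multiples A w"
proof -
  obtain b where b_in_K: "b \<in> K" and "b \<noteq> 0" and \<sigma>_u: "(\<sigma> ^^ d) u = b * u"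
    using eigenvector_\<sigma>_pow[OF u] .
  have "has_lead_coeff (r * u) d (b * (a * u))"
    using has_lead_coeff_mult[OF lead_r has_lead_coeff_scalar[OF u(1)]] \<sigma>_u
    by (simp add: central_left_commute[OF b_in_K])
  then have "b * (a * u) \<in> left_multiples A w"
    by (rule lead_coeff_of_left_multiple[OF w ru])
  then have "a * u \<in> left_multiples A w"
    using scale_mem_left_multiples_iff[OF b_in_K \<open>b \<noteq> 0\<close>] by blast
  then show ?thesis
    using regular_moduloD[OF regular] lead_r by (simp add: has_lead_coeff_def)
qed

theorem regular_modulo_extension:
  assumes u: "u \<in> A" "eigenvector \<sigma> u" and w: "w \<in> A" "eigenvector \<sigma> w"
    and "quasi_commute w u" and regular: "regular_modulo A w u"
  shows "regular_modulo B w u"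
proof
  fix r assume "r \<in> B" "r * u \<in> left_multiples B w"
  moreover obtain d where "r \<in> deg_lt d"
    using B_subset_deg_lt \<open>r \<in> B\<close> by blast
  ultimately show "r \<in> left_multiples B w"
  proof (induction d arbitrary: r)
    case 0
    then show ?case
      using left_multiplesI[OF B.zero_closed, of w] by (simp add: deg_lt_0)
  next
    case (Suc d)
    obtain a where lead_r: "has_lead_coeff r d a"
      using Suc.prems(3) deg_lt_Suc_iff by blast
    then have "a \<in> left_multiples A w"
      by (rule lead_coeff_mem_left_multiples[OF u w regular Suc.prems(2)])
    then obtain h where "h \<in> B" and lead_hw: "has_lead_coeff (h * w) d a"
      using left_multiple_with_lead_coeff[OF w] by blast
    have "r - h * w \<in> deg_lt d"
      using has_lead_coeff_diff[OF lead_r lead_hw] by (simp add: has_lead_coeff_zero_iff)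
    moreover have "r - h * w \<in> B"
      using Suc.prems(1) \<open>h \<in> B\<close> w(1) A_subset_B by blast
    moreover have "h * w * u \<in> left_multiples B w"
      using \<open>h \<in> B\<close> \<open>quasi_commute w u\<close> u(1) A_subset_B B.left_multiples_mult_quasi_commute by blast
    then have "(r - h * w) * u \<in> left_multiples B w"
      using Suc.prems(2) B.left_multiples_diff by (simp add: left_diff_distrib)
    ultimately have "r - h * w \<in> left_multiples B w"
      using Suc.IH by blast
    then have "r - h * w + h * w \<in> left_multiples B w"
      using \<open>h \<in> B\<close> by (intro B.left_multiples_add) auto
    then show ?case by simp
  qed
qed

end

section \<open>Intersections of localizations\<close>

lemma mult_set_mono: "I \<subseteq> J \<Longrightarrow> mult_set y I \<subseteq> mult_set y J"
proof
  fix e assume "I \<subseteq> J" and "e \<in> mult_set y I"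
  from this(2,1) show "e \<in> mult_set y J"
    by induction (auto intro: mult_set.intros)
qed

lemma localization_mono: "E \<subseteq> F \<Longrightarrow> localization A E \<subseteq> localization A F"
  by (auto simp: localization_def)

lemma mem_localization_iff:
  assumes "0 \<notin> E"
  shows "d \<in> localization A E \<longleftrightarrow> (\<exists>e\<in>E. d * e \<in> A)"
proof
  assume "d \<in> localization A E"
  then obtain r e where "r \<in> A" "e \<in> E" "d = r * inverse e"
    by (auto simp: localization_def)
  moreover have "e \<noteq> 0"
    using \<open>e \<in> E\<close> assms by blast
  ultimately show "\<exists>e\<in>E. d * e \<in> A"
    by (auto simp: mult.assoc intro!: bexI[of _ e])
next
  assume "\<exists>e\<in>E. d * e \<in> A"
  then obtain e where "e \<in> E" "d * e \<in> A"
    by blast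
  moreover have "e \<noteq> 0"
    using \<open>e \<in> E\<close> assms by blast
  then have "d = d * e * inverse e"
    by (simp add: mult.assoc)
  ultimately show "d \<in> localization A E"
    unfolding localization_def by blast
qed

locale quasi_commuting_family = subalgebra K A for K A :: "'a::division_ring set" +
  fixes y :: "nat \<Rightarrow> 'a" and S :: "nat set"
  assumes y_closed: "i \<in> S \<Longrightarrow> y i \<in> A"
    and y_nonzero: "i \<in> S \<Longrightarrow> y i \<noteq> 0"
    and y_quasi_commute: "i \<in> S \<Longrightarrow> j \<in> S \<Longrightarrow> quasi_commute (y i) (y j)"
    and y_regular_modulo: "i \<in> S \<Longrightarrow> j \<in> S \<Longrightarrow> i \<noteq> j \<Longrightarrow> regular_modulo A (y j) (y i)"
begin

lemma mult_set_closed: "e \<in> mult_set y I \<Longrightarrow> I \<subseteq> S \<Longrightarrow> e \<in> A"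
  by (induction rule: mult_set.induct) (auto intro: y_closed)

lemma zero_notin_mult_set:
  assumes "I \<subseteq> S"
  shows "0 \<notin> mult_set y I"
proof -
  have "e \<noteq> 0" if "e \<in> mult_set y I" for e
    using that by induction (use y_nonzero assms in auto)
  then show ?thesis by blast
qed

lemma mult_set_quasi_commute:
  assumes e: "e \<in> mult_set y I" and f: "f \<in> mult_set y J" and "I \<subseteq> S" "J \<subseteq> S"
  shows "quasi_commute e f"
proof (rule quasi_commute_mult_set[OF e])
  fix i assume "i \<in> I"
  then have "quasi_commute f (y i)"
    using \<open>I \<subseteq> S\<close> \<open>J \<subseteq> S\<close> by (intro quasi_commute_mult_set[OF f] y_quasi_commute) auto
  then show "quasi_commute (y i) f"
    by (rule quasi_commute_sym)
qed

lemma mult_set_regular_modulo: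
  assumes "f \<in> mult_set y J" "J \<subseteq> S" "k \<in> S - J"
  shows "regular_modulo A (y k) f"
  using assms(1)
proof induction
  case one
  show ?case by (rule regular_modulo_one)
next
  case (step f j)
  then show ?case
    by (intro regular_modulo_mult y_regular_modulo mult_set_closed) (use assms(2,3) in auto)
qed

lemma mult_set_factor:
  assumes "e \<in> mult_set y I" "I \<subseteq> S"
  shows "\<exists>c\<in>K. \<exists>g\<in>mult_set y (I \<inter> J). \<exists>h\<in>mult_set y (I - J). c \<noteq> 0 \<and> e = c * (g * h)"
  using assms(1)
proof induction
  case one
  show ?case
    using K_one by (intro bexI[of _ 1]) (auto intro: mult_set.one)
next
  case (step e k)
  then obtain c g h where "c \<in> K" "c \<noteq> 0" and g: "g \<in> mult_set y (I \<inter> J)"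
    and h: "h \<in> mult_set y (I - J)" and e_eq: "e = c * (g * h)"
    by blast
  show ?case
  proof (cases "k \<in> J")
    case True
    have "quasi_commute h (y k)"
      using assms(2) step(2) by (intro quasi_commute_mult_set[OF h] y_quasi_commute) auto
    then obtain b where b_in_K: "b \<in> K" and "b \<noteq> 0" and comm: "h * y k = b * (y k * h)" ..
    have "e * y k = c * b * (g * y k * h)"
      using comm e_eq by (simp add: mult.assoc central_left_commute[OF b_in_K])
    moreover have "g * y k \<in> mult_set y (I \<inter> J)"
      using g True step(2) by (intro mult_set.step) auto
    moreover have "c * b \<in> K" "c * b \<noteq> 0"
      using \<open>c \<in> K\<close> b_in_K \<open>c \<noteq> 0\<close> \<open>b \<noteq> 0\<close> K_mult by auto
    ultimately show ?thesis
      using h by blast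
  next
    case False
    have "e * y k = c * (g * (h * y k))"
      using e_eq by (simp add: mult.assoc)
    moreover have "h * y k \<in> mult_set y (I - J)"
      using h False step(2) by (intro mult_set.step) auto
    ultimately show ?thesis
      using \<open>c \<in> K\<close> \<open>c \<noteq> 0\<close> g by blast
  qed
qed

lemma coprime_denominators_cancel:
  assumes h: "h \<in> mult_set y I" and f: "f \<in> mult_set y J"
    and "I \<subseteq> S" "J \<subseteq> S" and disjoint: "I \<inter> J = {}"
    and dh: "d * h \<in> A" and df: "d * f \<in> A"
  shows "d \<in> A"
  using h dh
proof induction
  case one
  then show ?case by simp
next
  case (step h k)
  have k: "k \<in> S - J"
    using step(2) \<open>I \<subseteq> S\<close> disjoint by blast
  have "h * y k \<in> mult_set y I"
    using step(1,2) by (rule mult_set.step)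
  then have "quasi_commute (h * y k) f"
    using f \<open>I \<subseteq> S\<close> \<open>J \<subseteq> S\<close> by (rule mult_set_quasi_commute)
  then obtain c where c_in_K: "c \<in> K" and comm: "h * y k * f = c * (f * (h * y k))"
    by blast
  have "d * (h * y k) * f = c * (d * f) * h * y k"
    using comm by (simp add: mult.assoc central_left_commute[OF c_in_K])
  moreover have "c * (d * f) * h \<in> A"
    using c_in_K K_subset df mult_set_closed[OF step(1) \<open>I \<subseteq> S\<close>] by blast
  ultimately have "d * (h * y k) * f \<in> left_multiples A (y k)"
    by auto
  then have "d * (h * y k) \<in> left_multiples A (y k)"
    by (rule regular_moduloD[OF mult_set_regular_modulo[OF f \<open>J \<subseteq> S\<close> k] step.prems])
  then obtain s where "s \<in> A" "d * h * y k = s * y k"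
    by (auto simp: mult.assoc)
  then have "d * h \<in> A"
    using y_nonzero k by auto
  then show ?case
    by (rule step.IH)
qed

theorem localization_Int:
  assumes I: "I \<subseteq> S" and J: "J \<subseteq> S"
  shows "localization A (mult_set y I) \<inter> localization A (mult_set y J)
           = localization A (mult_set y (I \<inter> J))"
proof (intro equalityI subsetI)
  fix d assume "d \<in> localization A (mult_set y I) \<inter> localization A (mult_set y J)"
  then obtain e f where e: "e \<in> mult_set y I" and de: "d * e \<in> A"
    and f: "f \<in> mult_set y J" and df: "d * f \<in> A"
    by (auto simp: mem_localization_iff zero_notin_mult_set I J)
  obtain c g h where c_in_K: "c \<in> K" and "c \<noteq> 0" and g: "g \<in> mult_set y (I \<inter> J)"
    and h: "h \<in> mult_set y (I - J)" and e_eq: "e = c * (g * h)"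
    using mult_set_factor[OF e I] by blast
  have "c * (d * g * h) \<in> A"
    using de e_eq by (simp add: mult.assoc central_left_commute[OF c_in_K])
  then have "d * g * h \<in> A"
    using scale_closed_iff[OF c_in_K \<open>c \<noteq> 0\<close>] by blast
  moreover have "d * g * f \<in> A"
  proof -
    have "d * f * g \<in> A"
      using df mult_set_closed[OF g] I by blast
    moreover have "quasi_commute g f"
      using I J by (intro mult_set_quasi_commute[OF g f]) auto
    ultimately show ?thesis
      using quasi_commute_swap_closed by (simp add: mult.assoc)
  qed
  ultimately have "d * g \<in> A"
    using coprime_denominators_cancel[OF h f] I J by blast
  moreover have "I \<inter> J \<subseteq> S"
    using I by blast
  ultimately show "d \<in> localization A (mult_set y (I \<inter> J))"
    using g by (auto simp: mem_localization_iff zero_notin_mult_set)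
next
  fix d assume "d \<in> localization A (mult_set y (I \<inter> J))"
  then show "d \<in> localization A (mult_set y I) \<inter> localization A (mult_set y J)"
    using localization_mono[OF mult_set_mono] by (metis IntI Int_lower1 Int_lower2 subsetD)
qed

end

section \<open>Goodearl--Yakimov elements\<close>

locale goodearl_yakimov =
  fixes K :: "'a::division_ring set" and N n :: nat and x y :: "nat \<Rightarrow> 'a"
    and \<sigma> \<delta> :: "nat \<Rightarrow> 'a \<Rightarrow> 'a" and lam :: "nat \<Rightarrow> nat \<Rightarrow> 'a"
    and act :: "(nat \<Rightarrow> 'a) \<Rightarrow> 'a \<Rightarrow> 'a" and \<mu> :: "nat \<Rightarrow> nat"
  assumes qna: "QNA K N x \<sigma> \<delta> lam n act"
    and frac: "\<forall>d::'a. \<exists>a\<in>Rk K x N. \<exists>b\<in>Rk K x N. b \<noteq> 0 \<and> d = a * inverse b"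
    and gy: "GY_elements K N x n act \<mu> y"
begin

abbreviation R :: "nat \<Rightarrow> 'a set" where
  "R \<equiv> Rk K x"

sublocale central_subfield K
proof
  show "is_subfield K"
    using qna by (simp add: QNA_def)
  have central_R: "\<forall>c\<in>K. \<forall>r\<in>R N. c * r = r * c"
    using qna unfolding QNA_def by (elim conjE)
  fix c d assume "c \<in> K"
  obtain a b where "a \<in> R N" "b \<in> R N" and d_eq: "d = a * inverse b"
    using frac by blast
  have "c * inverse b = inverse b * c"
    using central_R \<open>c \<in> K\<close> \<open>b \<in> R N\<close> by (metis mult_commute_imp_mult_inverse_commute)
  moreover have "c * a = a * c"
    using central_R \<open>c \<in> K\<close> \<open>a \<in> R N\<close> by blast
  ultimately show "c * d = d * c"
    using d_eq by (metis mult.assoc)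
qed

sublocale R: subalgebra K "R k" for k
proof -
  interpret subring "R k"
    unfolding Rk_def by (rule subring_gen_ring)
  show "subalgebra K (R k)"
    by unfold_locales (auto simp: Rk_def intro: gen_ring.base)
qed

lemma R_mono: "j \<le> k \<Longrightarrow> R j \<subseteq> R k"
  unfolding Rk_def by (rule gen_ring_mono) auto

lemma R_Suc: "R (Suc k) = gen_ring (R k \<union> {x (Suc k)})"
proof
  have "K \<union> x ` {1..Suc k} \<subseteq> R k \<union> {x (Suc k)}"
    by (auto simp: Rk_def atLeastAtMostSuc_conv intro: gen_ring.base)
  then show "R (Suc k) \<subseteq> gen_ring (R k \<union> {x (Suc k)})"
    unfolding Rk_def[of K x "Suc k"] by (rule gen_ring_mono)
  have "x (Suc k) \<in> R (Suc k)"
    by (auto simp: Rk_def intro: gen_ring.base)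
  then show "gen_ring (R k \<union> {x (Suc k)}) \<subseteq> R (Suc k)"
    using R_mono[of k "Suc k"] by (intro gen_ring_least R.subring_axioms) auto
qed

lemma ore_extension_Suc:
  assumes "k < N"
  shows "ore_extension K (R k) (x (Suc k)) (\<sigma> (Suc k)) (\<delta> (Suc k))"
proof
  have "\<forall>k\<in>{1..N}. ore_ext K (R (k - 1)) (x k) (\<sigma> k) (\<delta> k)"
    using qna by (simp add: QNA_def)
  then show "ore_ext K (R k) (x (Suc k)) (\<sigma> (Suc k)) (\<delta> (Suc k))"
    using assms by (auto dest: bspec[of _ _ "Suc k"])
qed

lemma y_prime:
  assumes "k \<in> {1..N}"
  shows "y k \<in> R k \<and> prime_elt (R k) (y k)"
proof -
  have "\<forall>u. (u \<in> R k \<and> homogeneous K n act u \<and> prime_elt (R k) u) \<longleftrightarrow>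
        (\<exists>j\<in>{1..k}. (\<forall>j'\<in>{j<..k}. \<mu> j' \<noteq> \<mu> j) \<and> (\<exists>c\<in>K. c \<noteq> 0 \<and> u = c * y j))"
    using gy assms unfolding GY_elements_def by blast
  moreover have "k \<in> {1..k}" "\<forall>j'\<in>{k<..k}. \<mu> j' \<noteq> \<mu> k" "\<exists>c\<in>K. c \<noteq> 0 \<and> y k = c * y k"
    using assms K_one by (auto intro!: bexI[of _ 1])
  ultimately show ?thesis
    by blast
qed

lemma y_nonzero: "k \<in> {1..N} \<Longrightarrow> y k \<noteq> 0"
  using y_prime by (simp add: prime_elt_def)

lemma y_in_R: "k \<in> {1..m} \<Longrightarrow> m \<le> N \<Longrightarrow> y k \<in> R m"
  using y_prime[of k] R_mono[of k m] by auto

lemma y_Suc_linear: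
  assumes "k < N"
  obtains p c where "p \<in> R k" "p \<noteq> 0" "c \<in> R k" "y (Suc k) = p * x (Suc k) - c"
    "p = 1 \<or> p \<in> y ` {1..k}"
proof (cases "pred_set \<mu> (Suc k) = {}")
  case True
  then have "y (Suc k) = 1 * x (Suc k) - 0"
    using gy assms by (simp add: GY_elements_def)
  then show thesis
    using that[of 1 0] by simp
next
  case False
  define j where "j = Max (pred_set \<mu> (Suc k))"
  have "j \<in> pred_set \<mu> (Suc k)"
    unfolding j_def using False by (intro Max_in) (simp_all add: pred_set_def)
  then have j: "j \<in> {1..k}"
    by (auto simp: pred_set_def)
  have "\<exists>c\<in>R (Suc k - 1). y (Suc k) = y j * x (Suc k) - c"
    using gy assms False unfolding GY_elements_def j_def
    by (metis Suc_leI atLeastAtMost_iff le_add1 plus_1_eq_Suc)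
  then obtain c where "c \<in> R k" "y (Suc k) = y j * x (Suc k) - c"
    by auto
  then show thesis
    using that[of "y j" c] j assms y_nonzero[of j] y_in_R[of j k] by auto
qed

lemma y_eigenvector_\<sigma>:
  assumes "k < N" "i \<in> {1..k}"
  shows "eigenvector (\<sigma> (Suc k)) (y i)"
proof -
  have "\<forall>k\<in>{1..N}. \<exists>h\<in>torus K n. (\<forall>a\<in>R (k - 1). act h a = \<sigma> k a) \<and>
         (\<exists>q\<in>K. q \<noteq> 0 \<and> (\<forall>m::nat. m > 0 \<longrightarrow> q ^ m \<noteq> 1) \<and> act h (x k) = q * x k)"
    using qna unfolding QNA_def by (elim conjE)
  then obtain h where h: "h \<in> torus K n" "\<And>a. a \<in> R k \<Longrightarrow> act h a = \<sigma> (Suc k) a"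
    using assms(1) by (force dest: bspec[of _ _ "Suc k"])
  have "homogeneous K n act (y i)"
    using gy assms by (simp add: GY_elements_def)
  then show ?thesis
    using h y_in_R[of i k] assms by (auto simp: homogeneous_def eigenvector_def)
qed

lemma y_Suc_quasi_commute:
  assumes "k < N" "i \<in> {1..k}"
    and earlier: "\<And>j. j \<in> {1..k} \<Longrightarrow> quasi_commute (y j) (y i)"
  shows "quasi_commute (y (Suc k)) (y i)"
proof -
  interpret ore_extension K "R k" "x (Suc k)" "\<sigma> (Suc k)" "\<delta> (Suc k)"
    using \<open>k < N\<close> by (rule ore_extension_Suc)
  obtain p c where "p \<in> R k" "p \<noteq> 0" "c \<in> R k" and y_eq: "y (Suc k) = p * x (Suc k) - c"
    and p_cases: "p = 1 \<or> p \<in> y ` {1..k}"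
    using y_Suc_linear[OF \<open>k < N\<close>] .
  have lead: "has_lead_coeff (y (Suc k)) 1 p"
    unfolding y_eq using \<open>p \<in> R k\<close> \<open>c \<in> R k\<close> by (rule has_lead_coeff_linear)
  have "y i \<in> R k" "y i \<in> R (Suc k)"
    using assms(1,2) y_in_R by auto
  have "prime_elt (R (Suc k)) (y (Suc k))"
    using y_prime[of "Suc k"] \<open>k < N\<close> by simp
  then have "y (Suc k) * y i \<in> left_multiples (R (Suc k)) (y (Suc k))"
    using \<open>y i \<in> R (Suc k)\<close> unfolding prime_elt_def normal_elt_def left_multiples_def by blast
  moreover have "quasi_commute p (y i)"
    using p_cases earlier quasi_commute_one by blast
  ultimately show ?thesis
    using quasi_commute_from_lead_coeff[OF lead \<open>p \<noteq> 0\<close> \<open>y i \<in> R k\<close>] y_eigenvector_\<sigma>[OF assms(1,2)]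
    by (simp add: R_Suc)
qed

lemma y_quasi_commute_upto:
  "m \<le> N \<Longrightarrow> i \<in> {1..m} \<Longrightarrow> j \<in> {1..m} \<Longrightarrow> quasi_commute (y i) (y j)"
proof (induction m arbitrary: i j)
  case (Suc m)
  have new: "quasi_commute (y (Suc m)) (y k)" if "k \<in> {1..m}" for k
    using Suc that by (intro y_Suc_quasi_commute) auto
  have "i = Suc m \<or> i \<in> {1..m}" "j = Suc m \<or> j \<in> {1..m}"
    using Suc.prems by auto
  then show ?case
    using Suc.IH[of i j] Suc.prems(1) new[of i] new[of j] quasi_commute_sym quasi_commute_refl
    by (elim disjE) auto
qed simp

lemma y_Suc_regular_modulo:
  assumes "k < N" "i \<in> {1..k}"
  shows "regular_modulo (R (Suc k)) (y (Suc k)) (y i)"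
proof (rule prime_elt_regular_modulo)
  interpret ore_extension K "R k" "x (Suc k)" "\<sigma> (Suc k)" "\<delta> (Suc k)"
    using assms(1) by (rule ore_extension_Suc)
  obtain p c where "p \<in> R k" "p \<noteq> 0" "c \<in> R k" "y (Suc k) = p * x (Suc k) - c"
    using y_Suc_linear[OF assms(1)] .
  then have "has_lead_coeff (y (Suc k)) 1 p"
    using has_lead_coeff_linear by simp
  then show "y i \<notin> left_multiples (R (Suc k)) (y (Suc k))"
    using \<open>p \<noteq> 0\<close> assms y_in_R[of i k] y_nonzero[of i] not_left_multiple_of_higher_degree[of _ 1 p]
    by (simp add: R_Suc)
  show "prime_elt (R (Suc k)) (y (Suc k))"
    using y_prime[of "Suc k"] assms(1) by simp
  show "y i \<in> R (Suc k)"
    using y_in_R assms by simp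
qed

lemma y_regular_modulo_less:
  assumes "k \<in> {1..<l}" "l \<le> m" "m \<le> N"
  shows "regular_modulo (R m) (y l) (y k)"
  using assms(2,3)
proof (induction m rule: dec_induct)
  case base
  then show ?case
    using assms(1) y_Suc_regular_modulo[of "l - 1" k] by auto
next
  case (step m)
  interpret ore_extension K "R m" "x (Suc m)" "\<sigma> (Suc m)" "\<delta> (Suc m)"
    using step.prems by (intro ore_extension_Suc) auto
  have "k \<in> {1..m}" "l \<in> {1..m}"
    using assms(1) step.hyps by auto
  then show ?case
    unfolding R_Suc using step.prems step.IH
    by (intro regular_modulo_extension y_in_R y_eigenvector_\<sigma> y_quasi_commute_upto[of m]) auto
qed

sublocale quasi_commuting_family K "R N" y "{1..N}"
proof
  fix i j assume ij: "i \<in> {1..N}" "j \<in> {1..N}"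
  show "y i \<in> R N" "y i \<noteq> 0" "quasi_commute (y i) (y j)"
    using ij y_in_R y_nonzero y_quasi_commute_upto by blast+
  assume "i \<noteq> j"
  then consider "i < j" | "j < i"
    by linarith
  then show "regular_modulo (R N) (y j) (y i)"
  proof cases
    case 1
    then show ?thesis
      using ij by (intro y_regular_modulo_less) auto
  next
    case 2
    then have "regular_modulo (R N) (y i) (y j)"
      using ij by (intro y_regular_modulo_less) auto
    then show ?thesis
      by (rule R.regular_modulo_sym)
         (use ij in \<open>simp_all add: y_quasi_commute_upto[of N] y_nonzero\<close>)
  qed
qed

end

theorem theorem3p6:
  fixes K :: "'a::division_ring set" and N n :: nat and x y :: "nat \<Rightarrow> 'a"
    and \<sigma> \<delta> :: "nat \<Rightarrow> 'a \<Rightarrow> 'a" and lam :: "nat \<Rightarrow> nat \<Rightarrow> 'a"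
    and act :: "(nat \<Rightarrow> 'a) \<Rightarrow> 'a \<Rightarrow> 'a" and \<mu> :: "nat \<Rightarrow> nat"
    and I J :: "nat set"
  assumes qna: "QNA K N x \<sigma> \<delta> lam n act"
    and frac: "\<forall>d::'a. \<exists>a\<in>Rk K x N. \<exists>b\<in>Rk K x N. b \<noteq> 0 \<and> d = a * inverse b"
    and gy: "GY_elements K N x n act \<mu> y"
    and I: "I \<subseteq> {1..N}" and J: "J \<subseteq> {1..N}"
  shows "localization (Rk K x N) (mult_set y I) \<inter> localization (Rk K x N) (mult_set y J)
           = localization (Rk K x N) (mult_set y (I \<inter> J))"
proof -
  interpret goodearl_yakimov K N n x y \<sigma> \<delta> lam act \<mu>
    using qna frac gy by unfold_locales
  show ?thesis
    using I J by (rule localization_Int)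
qed

end
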